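(* Let $d$ be a positive integer, let $U\subseteq\mathbb{R}^{d-1}$ be an open set, and suppose that $F\in\mathcal{C}^2(U,\mathbb{R}^d)$ is a regular hypersurface, that is, the derivative $F'$ has rank $d-1$ everywhere on $U$. Then $\gamma(F(U))=0$.
   Context: $|\cdot|$ denotes the Euclidean norm. The proximal map of a convex function $f:\mathbb{R}^d\to\mathbb{R}$ is $\operatorname{prox}_f(x)=\arg\min_{y\in\mathbb{R}^d}\left(f(y)+\frac{|x-y|^2}{2}\right)$ (the unique minimizer). A function $f:\mathbb{R}^d\to\mathbb{R}$ is polyhedral if it is the maximum of finitely many affine functions. For a polyhedral function $f$, the generalized strip associated to $f$, denoted $S(f)$, is the set of points $x\in\mathbb{R}^d$ such that $f$ is not differentiable at $\operatorname{prox}_f(x)$. A set $S\subseteq\mathbb{R}^d$ is a generalized strip if $S=S(f)$ for some polyhedral $f$; its width is $w(S)=2\inf\{\operatorname{Lip} f : f \text{ polyhedral},\ S=S(f)\}$, where $\operatorname{Lip} f$ is the (best) Lipschitz constant of $f$. The outer measure $\gamma$ on subsets of $\mathbb{R}^d$ is $\gamma(A)=\inf\left\{\sum_{i=1}^\infty w(S_i) : S_1,S_2,\dots \text{ generalized strips with } A\subseteq\bigcup_{i=1}^\infty S_i\right\}$. *)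

theory Defs
  imports "HOL-Analysis.Analysis"
begin

definition prox :: "('a::euclidean_space \<Rightarrow> real) \<Rightarrow> 'a \<Rightarrow> 'a" where
  "prox f x = (ARG_MIN (\<lambda>y. f y + (norm (x - y))\<^sup>2 / 2) y. True)"

definition polyhedral :: "('a::euclidean_space \<Rightarrow> real) \<Rightarrow> bool" where
  "polyhedral f \<longleftrightarrow>
     (\<exists>P :: ('a \<times> real) set. finite P \<and> P \<noteq> {} \<and>
        f = (\<lambda>x. Max ((\<lambda>(a, b). a \<bullet> x + b) ` P)))"

definition strip_of :: "('a::euclidean_space \<Rightarrow> real) \<Rightarrow> 'a set" where
  "strip_of f = {x. \<not> f differentiable (at (prox f x))}"

definition generalized_strip :: "'a::euclidean_space set \<Rightarrow> bool" where
  "generalized_strip S \<longleftrightarrow> (\<exists>f. polyhedral f \<and> S = strip_of f)"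

(* The real-valued infima in Lip and width are meaningful for Lipschitz f and for
   generalized strips S respectively: otherwise the set is empty and Inf is unspecified. *)

definition Lip :: "('a::euclidean_space \<Rightarrow> real) \<Rightarrow> real" where
  "Lip f = Inf {L. lipschitz_on L UNIV f}"

definition width :: "'a::euclidean_space set \<Rightarrow> real" where
  "width S = 2 * Inf {Lip f | f. polyhedral f \<and> S = strip_of f}"

definition gamma_measure :: "'a::euclidean_space set \<Rightarrow> ennreal" where
  "gamma_measure A =
     Inf {(\<Sum>i. ennreal (width (S i))) | S :: nat \<Rightarrow> 'a set.
            (\<forall>i. generalized_strip (S i)) \<and> A \<subseteq> (\<Union>i. S i)}"

(* Used for open U: derivatives are taken in the ambient space. *)
definition C2_on :: "'b::real_normed_vector set \<Rightarrow> ('b \<Rightarrow> 'c::real_normed_vector) \<Rightarrow> bool" where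
  "C2_on U F \<longleftrightarrow>
     (\<exists>(F' :: 'b \<Rightarrow> 'b \<Rightarrow>\<^sub>L 'c) (F'' :: 'b \<Rightarrow> 'b \<Rightarrow>\<^sub>L ('b \<Rightarrow>\<^sub>L 'c)).
        (\<forall>x\<in>U. (F has_derivative blinfun_apply (F' x)) (at x)) \<and>
        (\<forall>x\<in>U. (F' has_derivative blinfun_apply (F'' x)) (at x)) \<and>
        continuous_on U F'')"

(* Neither real ^ 'm nor the class euclidean_space admits dimension 0.  A Euclidean space of
   dimension k >= 0 is therefore rendered as a real inner product space with a basis of k
   elements.  The instance below shows that dimension 0 does occur, with B = {}. *)

instantiation unit :: real_inner
begin

definition zero_unit :: unit where "zero_unit = ()"
definition plus_unit :: "unit \<Rightarrow> unit \<Rightarrow> unit" where "plus_unit x y = ()"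
definition scaleR_unit :: "real \<Rightarrow> unit \<Rightarrow> unit" where "scaleR_unit r x = ()"
definition inner_unit :: "unit \<Rightarrow> unit \<Rightarrow> real" where "inner_unit x y = 0"
definition norm_unit :: "unit \<Rightarrow> real" where "norm_unit x = 0"
definition sgn_unit :: "unit \<Rightarrow> unit" where "sgn_unit x = ()"
definition dist_unit :: "unit \<Rightarrow> unit \<Rightarrow> real" where "dist_unit x y = 0"
definition uniformity_unit :: "(unit \<times> unit) filter" where
  "uniformity_unit = (INF e\<in>{0<..}. principal {(x, y). dist x y < e})"
definition open_unit :: "unit set \<Rightarrow> bool" where
  "open_unit U \<longleftrightarrow> (\<forall>x\<in>U. eventually (\<lambda>(x', y). x' = x \<longrightarrow> y \<in> U) uniformity)"

instance
  by standard (auto simp: inner_unit_def norm_unit_def dist_unit_def uniformity_unit_def open_unit_def)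

end

lemma "finite ({} :: unit set)" "independent ({} :: unit set)" "span {} = (UNIV :: unit set)"
    "card ({} :: unit set) = 0"
  by (auto simp: UNIV_unit independent_empty)

end

(* Locally the hypersurface carries unit normals \<nu> p with \<bar>\<nu> p \<bullet> (q - p)\<bar> \<le> M |q - p|^2 for all its
   points p, q.  Let f be e times the maximum, over the points p of a finite e-net and over both
   signs, of the affine functions y \<mapsto> (tangent at p of M |y - x0|^2) \<plusminus> \<nu> p \<bullet> (y - p) / 2.
   Near x0 its slopes have norm at most e, so its strip has width at most 2 e.  If f were
   differentiable at y = prox f x for a point x of the hypersurface, then x - y would be the slope of
   any piece (p, \<plusminus>) active at y; hence x lies about e / 4 further from the tangent plane at p than y
   does, on the \<plusminus> side.  Activity forces y to lie on that side up to O(e^2), with a gain 2 M |y - p|^2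
   from the quadratic term, and for small e this contradicts the quadratic contact of x with the
   tangent plane at p.  So a single strip of arbitrarily small width covers the piece, and countably
   many pieces cover the hypersurface. *)

theory Submission
  imports Defs
begin

section \<open>Lipschitz constants and widths\<close>

lemma lipschitz_on_Max_affine:
  fixes P :: "('a::euclidean_space \<times> real) set"
  assumes "finite P" "P \<noteq> {}" "\<And>a b. (a, b) \<in> P \<Longrightarrow> norm a \<le> L"
  shows "L-lipschitz_on UNIV (\<lambda>x. Max ((\<lambda>(a, b). a \<bullet> x + b) ` P))"
proof (rule lipschitz_onI)
  let ?f = "\<lambda>x. Max ((\<lambda>(a, b). a \<bullet> x + b) ` P)"
  obtain a0 b0 where "(a0, b0) \<in> P"
    using \<open>P \<noteq> {}\<close> by auto
  with assms(3) show "0 \<le> L"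
    using norm_ge_zero order_trans by blast
  have le: "?f x \<le> ?f y + L * norm (x - y)" for x y
  proof -
    have "a \<bullet> x + b \<le> ?f y + L * norm (x - y)" if "(a, b) \<in> P" for a b
    proof -
      have "a \<bullet> y + b \<le> ?f y"
        using that assms(1) by (intro Max_ge) force+
      moreover have "a \<bullet> (x - y) \<le> norm a * norm (x - y)"
        by (rule norm_cauchy_schwarz)
      moreover have "norm a * norm (x - y) \<le> L * norm (x - y)"
        using assms(3)[OF that] by (rule mult_right_mono) simp
      ultimately show ?thesis by (simp add: inner_diff_right)
    qed
    then show ?thesis
      using assms(1,2) by auto
  qed
  show "dist (?f x) (?f y) \<le> L * dist x y" for x y
    using le[of x y] le[of y x] by (simp add: dist_norm norm_minus_commute abs_le_iff)
qed

lemma polyhedral_lipschitz: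
  assumes "polyhedral f"
  obtains L where "L-lipschitz_on UNIV f"
proof -
  obtain P where P: "finite P" "P \<noteq> {}" "f = (\<lambda>x. Max ((\<lambda>(a, b). a \<bullet> x + b) ` P))"
    using assms unfolding polyhedral_def by blast
  have "norm a \<le> Max ((norm \<circ> fst) ` P)" if "(a, b) \<in> P" for a b
    using that P(1) by (intro Max_ge) force+
  with P that show ?thesis
    using lipschitz_on_Max_affine by metis
qed

lemma Lip_le:
  assumes "L-lipschitz_on UNIV f"
  shows "Lip f \<le> L"
  unfolding Lip_def using assms
  by (intro cInf_lower bdd_belowI[of _ 0]) (auto dest: lipschitz_on_nonneg)

text \<open>A real \<open>Inf\<close> can only be estimated from below over a nonempty set; the
  finitely many slopes of \<open>f\<close> provide a member. The bound then keeps the infimum in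
  \<open>width\<close> bounded below, so that \<open>width_strip_of_le\<close> can compare it with
  one of its members.\<close>

lemma Lip_nonneg:
  assumes "polyhedral f"
  shows "0 \<le> Lip f"
proof -
  obtain L where "L-lipschitz_on UNIV f"
    using polyhedral_lipschitz[OF assms] .
  then show ?thesis
    unfolding Lip_def by (intro cInf_greatest) (auto dest: lipschitz_on_nonneg)
qed

lemma width_strip_of_le:
  assumes "polyhedral f" "L-lipschitz_on UNIV f"
  shows "width (strip_of f) \<le> 2 * L"
proof -
  have "Inf {Lip g | g. polyhedral g \<and> strip_of f = strip_of g} \<le> Lip f"
    using assms(1) Lip_nonneg by (intro cInf_lower bdd_belowI[of _ 0]) auto
  with Lip_le[OF assms(2)] show ?thesis
    unfolding width_def by simp
qed

section \<open>The proximal map and first-order conditions\<close>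

lemma prox_minimizes:
  fixes f :: "'a::euclidean_space \<Rightarrow> real"
  assumes "L-lipschitz_on UNIV f"
  shows "f (prox f x) + (norm (x - prox f x))\<^sup>2 / 2 \<le> f z + (norm (x - z))\<^sup>2 / 2"
proof -
  let ?g = "\<lambda>y. f y + (norm (x - y))\<^sup>2 / 2"
  have L: "0 \<le> L"
    using assms by (rule lipschitz_on_nonneg)
  \<comment> \<open>Outside this ball |x - z|^2 / 2 is at least L |x - z|, which outweighs any
    decrease of \<open>f\<close> from \<open>x\<close> to \<open>z\<close>. Hence a minimum over the
    compact ball is global.\<close>
  have "continuous_on (cball x (2 * L)) ?g"
    using lipschitz_on_continuous_on[OF assms]
    by (intro continuous_intros) (auto intro: continuous_on_subset)
  then have "\<exists>y\<in>cball x (2 * L). \<forall>z\<in>cball x (2 * L). ?g y \<le> ?g z"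
    using L by (intro continuous_attains_inf compact_cball) auto
  then obtain y where y: "\<And>z. z \<in> cball x (2 * L) \<Longrightarrow> ?g y \<le> ?g z"
    by blast
  have "?g y \<le> ?g z" for z
  proof (cases "z \<in> cball x (2 * L)")
    case False
    then have far: "2 * L \<le> norm (x - z)"
      by (simp add: dist_norm)
    have "\<bar>f x - f z\<bar> \<le> L * norm (x - z)"
      using lipschitz_onD[OF assms, of x z] by (simp add: dist_norm)
    moreover have "2 * L * norm (x - z) \<le> (norm (x - z))\<^sup>2"
      using mult_right_mono[OF far norm_ge_zero[of "x - z"]] by (simp add: power2_eq_square)
    moreover have "?g y \<le> ?g x"
      using L by (intro y) simp
    ultimately show ?thesis by (simp add: abs_le_iff)
  qed (rule y)
  \<comment> \<open>\<open>prox\<close> is defined by choice, so the existence of one minimiser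
    makes the chosen point a minimiser too.\<close>
  then have "is_arg_min ?g (\<lambda>_. True) y"
    by (simp add: is_arg_min_linorder)
  then have "is_arg_min ?g (\<lambda>_. True) (prox f x)"
    unfolding prox_def arg_min_def by (rule someI)
  then show ?thesis
    by (simp add: is_arg_min_linorder)
qed

text \<open>Two functions have a minimum at y = \<open>prox f x\<close>: \<open>f\<close> minus the
  affine minorant touching it there, and \<open>f\<close> plus half the squared distance to
  \<open>x\<close>. If \<open>f\<close> has a derivative at y, the first identifies it with
  \<open>a\<close> and the second with x - y.\<close>

lemma diff_prox_eq_slope:
  fixes f :: "'a::euclidean_space \<Rightarrow> real"
  assumes lip: "L-lipschitz_on UNIV f"
    and diff: "f differentiable (at (prox f x))"
    and below: "\<And>z. a \<bullet> z + b \<le> f z"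
    and active: "f (prox f x) = a \<bullet> prox f x + b"
  shows "x - prox f x = a"
proof -
  let ?y = "prox f x"
  obtain D where D: "(f has_derivative D) (at ?y)"
    using diff unfolding differentiable_def by blast
  have "((\<lambda>z. f z - (a \<bullet> z + b)) has_derivative (\<lambda>v. D v - a \<bullet> v)) (at ?y)"
    by (auto intro!: derivative_eq_intros D)
  moreover have "f ?y - (a \<bullet> ?y + b) \<le> f z - (a \<bullet> z + b)" for z
    using below[of z] active by simp
  ultimately have 1: "(\<lambda>v. D v - a \<bullet> v) = (\<lambda>v. 0)"
    by (intro has_derivative_local_min) auto
  have "((\<lambda>z. f z + (norm (x - z))\<^sup>2 / 2) has_derivative (\<lambda>v. D v - (x - ?y) \<bullet> v)) (at ?y)"
    unfolding power2_norm_eq_inner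
    by (auto intro!: derivative_eq_intros D simp: inner_commute field_simps)
  then have 2: "(\<lambda>v. D v - (x - ?y) \<bullet> v) = (\<lambda>v. 0)"
    using prox_minimizes[OF lip] by (intro has_derivative_local_min) auto
  have "(x - ?y) \<bullet> v = a \<bullet> v" for v
    using fun_cong[OF 1, of v] fun_cong[OF 2, of v] by simp
  then show ?thesis
    by (metis vector_eq_rdot)
qed

section \<open>Sets inside single strips of arbitrarily small width\<close>

definition thin :: "'a::euclidean_space set \<Rightarrow> bool" where
  "thin A \<longleftrightarrow> (\<forall>e>0. \<exists>f. polyhedral f \<and> e-lipschitz_on UNIV f \<and> A \<subseteq> strip_of f)"

lemma thin_subset: "thin A \<Longrightarrow> B \<subseteq> A \<Longrightarrow> thin B"
  unfolding thin_def by (meson order_trans)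

lemma thin_empty: "thin ({} :: 'a::euclidean_space set)"
proof -
  have "polyhedral (\<lambda>x::'a. 0)"
    unfolding polyhedral_def by (intro exI[of _ "{(0, 0)}"]) simp
  moreover have "e-lipschitz_on UNIV (\<lambda>x::'a. 0 :: real)" if "e > 0" for e
    using that by (intro lipschitz_onI) auto
  ultimately show ?thesis
    unfolding thin_def by blast
qed

lemma gamma_measure_thin_UN:
  fixes A :: "nat \<Rightarrow> 'a::euclidean_space set"
  assumes thin: "\<And>i. thin (A i)"
  shows "gamma_measure (\<Union>i. A i) = 0"
proof -
  have "gamma_measure (\<Union>i. A i) \<le> ennreal e" if "e > 0" for e :: real
  proof -
    \<comment> \<open>The strip for \<open>A i\<close> has width at most twice this constant, and
      these bounds form a geometric series with sum \<open>e\<close>.\<close>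
    have "\<exists>f. polyhedral f \<and> (e / 4 * (1/2) ^ i)-lipschitz_on UNIV f \<and> A i \<subseteq> strip_of f" for i
      using thin[of i] that unfolding thin_def by simp
    then obtain f where f: "\<And>i. polyhedral (f i)"
        "\<And>i. (e / 4 * (1/2) ^ i)-lipschitz_on UNIV (f i)" "\<And>i. A i \<subseteq> strip_of (f i)"
      by metis
    have sums: "(\<lambda>i. e / 2 * (1/2) ^ i) sums e"
      using sums_mult[OF geometric_sums[of "1/2 :: real"], of "e / 2"] by simp
    have "gamma_measure (\<Union>i. A i) \<le> (\<Sum>i. ennreal (width (strip_of (f i))))"
      unfolding gamma_measure_def generalized_strip_def
      by (intro Inf_lower CollectI exI[of _ "\<lambda>i. strip_of (f i)"] conjI refl) (use f in blast)+
    also have "\<dots> \<le> (\<Sum>i. ennreal (e / 2 * (1/2) ^ i))"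
      using width_strip_of_le[OF f(1,2)]
      by (intro suminf_le ennreal_leI summableI) (auto simp: field_simps)
    also have "\<dots> = ennreal e"
      using sums that by (subst suminf_ennreal_eq[OF _ sums]) auto
    finally show ?thesis .
  qed
  then show ?thesis
    using ennreal_le_epsilon[of 0 "gamma_measure (\<Union>i. A i)"] by simp
qed

section \<open>Quadratic contact implies thinness\<close>

text \<open>The left side is the tangent at \<open>p\<close> of the function K/2 |y - x0|^2 of
  \<open>y\<close>. Being quadratic, this function exceeds its tangent by exactly K/2 |y -
  p|^2.\<close>

lemma norm_diff_eq_quadratic:
  fixes x0 p y :: "'a::real_inner"
  shows "(K *\<^sub>R (p - x0)) \<bullet> (y - p) + K / 2 * (norm (p - x0))\<^sup>2
    = K / 2 * (norm (y - x0))\<^sup>2 - K / 2 * (norm (y - p))\<^sup>2"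
  unfolding power2_norm_eq_inner by (simp add: inner_simps inner_commute field_simps)

text \<open>The condition \<open>8 * M * r \<le> 1\<close> keeps the gradient 2 M (p - x0) of the
  quadratic at norm at most 1/4, half the length of the normal term. It serves twice: slopes stay of
  norm at most \<open>e\<close>, and their component along the signed normal stays at least e /
  4.\<close>

lemma thin_if_quadratic_contact:
  fixes A :: "'a::euclidean_space set" and \<nu> :: "'a \<Rightarrow> 'a"
  assumes unit: "\<And>p. p \<in> A \<Longrightarrow> norm (\<nu> p) = 1"
    and contact: "\<And>p q. p \<in> A \<Longrightarrow> q \<in> A \<Longrightarrow> \<bar>\<nu> p \<bullet> (q - p)\<bar> \<le> M * (norm (q - p))\<^sup>2"
    and near: "\<And>p. p \<in> A \<Longrightarrow> norm (p - x0) \<le> r"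
    and M: "0 < M" and small: "8 * M * r \<le> 1"
  shows "thin A"
proof (cases "A = {}")
  case True
  then show ?thesis by (simp add: thin_empty)
next
  case False
  show ?thesis
    unfolding thin_def
  proof (intro allI impI)
    fix e0 :: real assume "e0 > 0"
    \<comment> \<open>The cap forces 40 M e < 1, which the inequality e / 4 <= 10 M e^2 reached at
      the end violates.\<close>
    define e where "e = min e0 (1 / (80 * M))"
    have e: "e > 0" "e \<le> e0" "40 * M * e < 1"
      using \<open>e0 > 0\<close> M by (auto simp: e_def min_def field_simps)
    have "A \<subseteq> cball x0 r"
      using near by (auto simp: dist_norm norm_minus_commute)
    then have "bounded A"
      using bounded_subset bounded_cball by blast
    then have "compact (closure A)" by simp
    \<comment> \<open>Balls centred in \<open>A\<close> already cover the closure, so the net lies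
      in \<open>A\<close> itself, where the normals and the contact bound are available.\<close>
    moreover have cover: "closure A \<subseteq> (\<Union>p\<in>A. ball p e)"
      using e(1) by (auto simp: closure_approachable)
    ultimately obtain N where N: "N \<subseteq> A" "finite N" "closure A \<subseteq> (\<Union>p\<in>N. ball p e)"
      by (rule compactE_image[OF _ open_ball])
    define slope where "slope p s = e *\<^sub>R ((2 * M) *\<^sub>R (p - x0) + (s / 2) *\<^sub>R \<nu> p)" for p and s :: real
    define val where "val p = e * (M * (norm (p - x0))\<^sup>2)" for p :: 'a
    define P where "P = (\<lambda>(p, s). (slope p s, val p - slope p s \<bullet> p)) ` (N \<times> {-1, 1})"
    define f where "f = (\<lambda>x. Max ((\<lambda>(a, b). a \<bullet> x + b) ` P))"
    have P: "finite P" "P \<noteq> {}"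
      using N False by (auto simp: P_def)
    have slope_le: "norm (slope p s) \<le> e" if "p \<in> N" "s \<in> {-1, 1}" for p s
    proof -
      have "2 * M * norm (p - x0) \<le> 1/4"
      proof -
        have "norm (p - x0) \<le> r"
          using near that(1) N(1) by blast
        then have "M * norm (p - x0) \<le> M * r"
          using M by (simp add: mult_left_mono)
        then show ?thesis using small by simp
      qed
      then have "norm ((2 * M) *\<^sub>R (p - x0) + (s / 2) *\<^sub>R \<nu> p) \<le> 1"
        using that N(1) M unit[of p] by (intro norm_triangle_le) auto
      then show ?thesis
        using e(1) by (simp add: slope_def)
    qed
    have "polyhedral f"
      using P unfolding polyhedral_def f_def by blast
    have lip: "e-lipschitz_on UNIV f"
      unfolding f_def using slope_le by (intro lipschitz_on_Max_affine P) (auto simp: P_def)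
    \<comment> \<open>All pieces share the term M |y - x0|^2, which cancels when two of them are
      compared; what remains penalises a piece by M |y - p|^2.\<close>
    have piece: "slope p s \<bullet> y + (val p - slope p s \<bullet> p)
        = e * (M * (norm (y - x0))\<^sup>2 - M * (norm (y - p))\<^sup>2 + s / 2 * (\<nu> p \<bullet> (y - p)))" for p s y
    proof -
      have "slope p s \<bullet> y + (val p - slope p s \<bullet> p) = e * ((2 * M) *\<^sub>R (p - x0) \<bullet> (y - p)
          + 2 * M / 2 * (norm (p - x0))\<^sup>2 + s / 2 * (\<nu> p \<bullet> (y - p)))"
        by (simp add: slope_def val_def inner_diff_right inner_add_left algebra_simps)
      then show ?thesis
        unfolding norm_diff_eq_quadratic by simp
    qed
    have "A \<subseteq> strip_of f"
    proof
      fix x assume x: "x \<in> A"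
      define y where "y = prox f x"
      show "x \<in> strip_of f"
        unfolding strip_of_def
      proof (rule CollectI, rule notI)
        assume diff: "f differentiable (at (prox f x))"
        have below: "a \<bullet> z + b \<le> f z" if "(a, b) \<in> P" for a b z
          unfolding f_def using that P(1) by (intro Max_ge) force+
        have "f y \<in> (\<lambda>(a, b). a \<bullet> y + b) ` P"
          unfolding f_def using P by (intro Max_in) auto
        then obtain p s where p: "p \<in> N" "s \<in> {-1, 1}"
            and active: "f y = slope p s \<bullet> y + (val p - slope p s \<bullet> p)"
          unfolding P_def by auto
        have inP: "(slope p s, val p - slope p s \<bullet> p) \<in> P" if "p \<in> N" "s \<in> {-1, 1}" for p s
          using that unfolding P_def by force
        have xy: "x - y = slope p s"
          using diff_prox_eq_slope[OF lip diff below[OF inP[OF p]]] active unfolding y_def by blast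
        obtain q where q: "q \<in> N" "norm (x - q) < e"
          using N(3) closure_subset x by (force simp: dist_norm norm_minus_commute)
        \<comment> \<open>The piece (q, t) is the competitor of the active one. This sign makes its
          normal term nonnegative, so after cancelling the common term and the factor
          \<open>e\<close> its value is at least - M |y - q|^2 >= - 4 M e^2.\<close>
        define t where "t = (if \<nu> q \<bullet> (y - q) \<ge> 0 then 1 else -1 :: real)"
        have t: "t \<in> {-1, 1}" "t / 2 * (\<nu> q \<bullet> (y - q)) \<ge> 0"
          by (auto simp: t_def)
        have nxy: "norm (x - y) \<le> e"
          using xy slope_le[OF p] by simp
        have "norm (y - q) \<le> 2 * e"
          using norm_triangle_ineq4[of "x - q" "x - y"] nxy q(2) by simp
        then have yq: "(norm (y - q))\<^sup>2 \<le> 4 * e\<^sup>2"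
          using power_mono[of _ "2 * e" 2] by fastforce
        have pA: "p \<in> A" using p N by auto
        have "e * (M * (norm (y - x0))\<^sup>2 - M * (norm (y - q))\<^sup>2 + t / 2 * (\<nu> q \<bullet> (y - q)))
            \<le> e * (M * (norm (y - x0))\<^sup>2 - M * (norm (y - p))\<^sup>2 + s / 2 * (\<nu> p \<bullet> (y - p)))"
          using below[OF inP[OF q(1) t(1)], of y] active by (simp only: piece)
        then have "- M * (norm (y - q))\<^sup>2 \<le> - M * (norm (y - p))\<^sup>2 + s / 2 * (\<nu> p \<bullet> (y - p))"
          using e(1) t(2) by (simp add: mult_le_cancel_left_pos)
        moreover have "M * (norm (y - q))\<^sup>2 \<le> M * (4 * e\<^sup>2)"
          using yq M by (simp add: mult_left_mono)
        ultimately have 1: "s * (\<nu> p \<bullet> (y - p)) \<ge> 2 * M * (norm (y - p))\<^sup>2 - 8 * M * e\<^sup>2"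
          by simp
        have 2: "s * (\<nu> p \<bullet> (x - y)) \<ge> e / 4"
        proof -
          have sq: "\<nu> p \<bullet> \<nu> p = 1" "s * s = 1"
            using unit[OF pA] p(2) by (auto simp: norm_eq_1)
          have "\<bar>\<nu> p \<bullet> (p - x0)\<bar> \<le> r"
            using Cauchy_Schwarz_ineq2[of "\<nu> p" "p - x0"] unit[OF pA] near[OF pA] by simp
          then have "2 * M * \<bar>\<nu> p \<bullet> (p - x0)\<bar> \<le> 1/4"
            using M small mult_left_mono[of "\<bar>\<nu> p \<bullet> (p - x0)\<bar>" r M] by linarith
          moreover have "\<bar>s * (2 * M * (\<nu> p \<bullet> (p - x0)))\<bar> = 2 * M * \<bar>\<nu> p \<bullet> (p - x0)\<bar>"
            using p(2) M by (auto simp: abs_mult)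
          ultimately have "s * (2 * M * (\<nu> p \<bullet> (p - x0))) + 1/2 \<ge> 1/4" by linarith
          then have "e * (s * (2 * M * (\<nu> p \<bullet> (p - x0))) + 1/2) \<ge> e * (1/4)"
            using e(1) by (intro mult_left_mono) auto
          moreover have "s * (\<nu> p \<bullet> (x - y)) = e * (s * (2 * M * (\<nu> p \<bullet> (p - x0))) + s * s / 2 * (\<nu> p \<bullet> \<nu> p))"
            unfolding xy slope_def by (simp add: inner_add_right algebra_simps)
          ultimately show ?thesis using sq by simp
        qed
        have 3: "s * (\<nu> p \<bullet> (x - p)) \<le> M * (norm (x - p))\<^sup>2"
          using contact[OF pA x] p(2) by auto
        have "(norm (x - p))\<^sup>2 \<le> (norm (x - y) + norm (y - p))\<^sup>2"
          using norm_triangle_ineq[of "x - y" "y - p"] by (intro power_mono) auto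
        also have "\<dots> \<le> 2 * (norm (x - y))\<^sup>2 + 2 * (norm (y - p))\<^sup>2"
          using sum_squares_ge_zero[of "norm (x - y) - norm (y - p)" 0]
          by (simp add: power2_eq_square algebra_simps)
        also have "\<dots> \<le> 2 * e\<^sup>2 + 2 * (norm (y - p))\<^sup>2"
          using nxy by (simp add: power_mono)
        finally have "M * (norm (x - p))\<^sup>2 \<le> M * (2 * e\<^sup>2 + 2 * (norm (y - p))\<^sup>2)"
          using M by (simp add: mult_left_mono)
        \<comment> \<open>Adding \<open>1\<close> and \<open>2\<close> bounds the signed height of
          \<open>x\<close> over the tangent plane at \<open>p\<close> from below by e/4 + 2 M |y -
          p|^2 - 8 M e^2, while \<open>3\<close> bounds it from above by 2 M e^2 + 2 M |y - p|^2.
          The terms in |y - p|^2 cancel, so it does not matter how far the active \<open>p\<close>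
          is from \<open>y\<close>.\<close>
        with 1 2 3 have "e / 4 \<le> 10 * M * e\<^sup>2"
          by (simp add: inner_diff_right algebra_simps)
        then have "e * 1 \<le> e * (40 * M * e)"
          by (simp add: power2_eq_square algebra_simps)
        with e show False
          by (simp add: mult_le_cancel_left_pos)
      qed
    qed
    moreover have "e0-lipschitz_on UNIV f"
      using lip e(2) lipschitz_on_le by blast
    ultimately show "\<exists>f. polyhedral f \<and> e0-lipschitz_on UNIV f \<and> A \<subseteq> strip_of f"
      using \<open>polyhedral f\<close> by blast
  qed
qed

section \<open>From C^2 immersions to quadratic contact\<close>

text \<open>Continuity bounds the second derivative by \<open>C\<close> on a small ball. The mean
  value inequality, applied first to \<open>F'\<close> and then to \<open>F\<close> minus its
  linearisation, gives both estimates with the same constant.\<close>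

lemma C2_on_imp_quadratic_remainder:
  fixes F :: "'b::real_normed_vector \<Rightarrow> 'c::real_normed_vector"
  assumes "C2_on U F" "open U" "u0 \<in> U"
  obtains F' :: "'b \<Rightarrow> 'b \<Rightarrow>\<^sub>L 'c" and C r where "0 < C" "0 < r" "ball u0 r \<subseteq> U"
    and "\<And>u. u \<in> U \<Longrightarrow> (F has_derivative F' u) (at u)"
    and "\<And>u v. u \<in> ball u0 r \<Longrightarrow> v \<in> ball u0 r \<Longrightarrow> norm (F' v - F' u) \<le> C * norm (v - u)"
    and "\<And>u v. u \<in> ball u0 r \<Longrightarrow> v \<in> ball u0 r \<Longrightarrow>
      norm (F v - F u - F' u (v - u)) \<le> C * (norm (v - u))\<^sup>2"
proof -
  obtain F' F'' where F': "\<And>u. u \<in> U \<Longrightarrow> (F has_derivative blinfun_apply (F' u)) (at u)"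
    and F'': "\<And>u. u \<in> U \<Longrightarrow> (F' has_derivative blinfun_apply (F'' u)) (at u)"
    and cont: "continuous_on U F''"
    using assms(1) unfolding C2_on_def by blast
  define C where "C = norm (F'' u0) + 1"
  have "isCont F'' u0"
    using cont assms by (simp add: continuous_on_eq_continuous_at)
  then obtain r1 where r1: "r1 > 0" "\<And>w. dist w u0 < r1 \<Longrightarrow> dist (F'' w) (F'' u0) < 1"
    by (metis continuous_at zero_less_one LIM_def dist_self)
  obtain r2 where r2: "r2 > 0" "ball u0 r2 \<subseteq> U"
    using assms openE by blast
  define r where "r = min r1 r2"
  have r: "0 < r" "ball u0 r \<subseteq> U"
    using r1 r2 by (auto simp: r_def)
  have bd: "norm (F'' w) \<le> C" if "w \<in> ball u0 r" for w
  proof -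
    have "dist (F'' w) (F'' u0) < 1"
      using that by (intro r1) (auto simp: r_def dist_commute)
    then show ?thesis
      using norm_triangle_ineq2[of "F'' w" "F'' u0"] by (simp add: C_def dist_norm)
  qed
  have lip: "norm (F' v - F' u) \<le> C * norm (v - u)" if "u \<in> ball u0 r" "v \<in> ball u0 r" for u v
  proof (rule differentiable_bound[OF convex_ball _ _ that(2,1)])
    fix w assume w: "w \<in> ball u0 r"
    show "(F' has_derivative F'' w) (at w within ball u0 r)"
      using w r F'' by (blast intro: has_derivative_at_withinI)
    show "onorm (F'' w) \<le> C"
      using bd[OF w] by (simp add: norm_blinfun.rep_eq)
  qed
  have "norm (F v - F u - F' u (v - u)) \<le> C * (norm (v - u))\<^sup>2"
    if uv: "u \<in> ball u0 r" "v \<in> ball u0 r" for u v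
  proof -
    \<comment> \<open>Still convex and containing both points, this set also ensures |w - u| <= |v -
      u|, so the derivative \<open>F' w - F' u\<close> is bounded by C |v - u| throughout.\<close>
    let ?S = "ball u0 r \<inter> cball u (norm (v - u))"
    have "norm ((F v - F' u v) - (F u - F' u u)) \<le> C * norm (v - u) * norm (v - u)"
    proof (rule differentiable_bound[of ?S _ "\<lambda>w. blinfun_apply (F' w - F' u)"])
      show "convex ?S"
        by (intro convex_Int convex_ball convex_cball)
      fix w assume w: "w \<in> ?S"
      have "(F has_derivative F' w) (at w within ?S)"
        using w r F' by (blast intro: has_derivative_at_withinI)
      then show "((\<lambda>w. F w - F' u w) has_derivative blinfun_apply (F' w - F' u)) (at w within ?S)"
        unfolding blinfun.diff_left
        by (intro has_derivative_diff bounded_linear_imp_has_derivative blinfun.bounded_linear_right)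
      have "norm (F' w - F' u) \<le> C * norm (w - u)"
        using lip[of u w] w uv by simp
      also have "\<dots> \<le> C * norm (v - u)"
        using w by (intro mult_left_mono) (auto simp: C_def dist_norm norm_minus_commute)
      finally show "onorm (F' w - F' u) \<le> C * norm (v - u)"
        by (simp add: norm_blinfun.rep_eq)
    qed (use uv in \<open>auto simp: dist_norm norm_minus_commute\<close>)
    then show ?thesis
      by (simp add: blinfun.diff_right algebra_simps power2_eq_square)
  qed
  moreover have "0 < C"
    unfolding C_def by (simp add: add_nonneg_pos)
  ultimately show ?thesis
    using that r F' lip by blast
qed

lemma unit_normal_exists:
  fixes f :: "'b::real_vector \<Rightarrow> 'a::euclidean_space"
  assumes "dim (range f) < DIM('a)"
  obtains n where "norm n = 1" "\<And>v. n \<bullet> f v = 0"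
proof -
  obtain x where x: "x \<noteq> 0" "\<And>y. y \<in> span (range f) \<Longrightarrow> orthogonal x y"
    using orthogonal_to_subspace_exists[OF assms] by blast
  have "(x /\<^sub>R norm x) \<bullet> f v = 0" for v
    using x(2)[of "f v"] by (simp add: orthogonal_def span_base)
  with x(1) that[of "x /\<^sub>R norm x"] show ?thesis by simp
qed

text \<open>The remainder is quadratic in the parameters, whereas contact is measured in the ambient
  space. The left inverse \<open>G\<close> bridges the two: it bounds parameter distances near
  \<open>u0\<close> by a multiple of the distances between image points.\<close>

lemma C2_immersion_locally_thin:
  fixes F :: "'b::real_normed_vector \<Rightarrow> 'a::euclidean_space" and G :: "'a \<Rightarrow> 'b"
  assumes C2: "C2_on U F" and U: "open U" "u0 \<in> U"
    and G: "bounded_linear G" "\<And>v. G (frechet_derivative F (at u0) v) = v"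
    and dim: "\<And>u. u \<in> U \<Longrightarrow> dim (range (frechet_derivative F (at u))) < DIM('a)"
  obtains V where "open V" "u0 \<in> V" "thin (F ` V)"
proof -
  obtain F' :: "'b \<Rightarrow> 'b \<Rightarrow>\<^sub>L 'a" and C r where C: "0 < C" and r: "0 < r" "ball u0 r \<subseteq> U"
    and F': "\<And>u. u \<in> U \<Longrightarrow> (F has_derivative F' u) (at u)"
    and lip: "\<And>u v. u \<in> ball u0 r \<Longrightarrow> v \<in> ball u0 r \<Longrightarrow> norm (F' v - F' u) \<le> C * norm (v - u)"
    and rem: "\<And>u v. u \<in> ball u0 r \<Longrightarrow> v \<in> ball u0 r \<Longrightarrow>
      norm (F v - F u - F' u (v - u)) \<le> C * (norm (v - u))\<^sup>2"
    using C2_on_imp_quadratic_remainder[OF C2 U] by metis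
  have fre: "frechet_derivative F (at u) = blinfun_apply (F' u)" if "u \<in> U" for u
    using frechet_derivative_at[OF F'[OF that]] by simp
  obtain K where K: "0 < K" "\<And>x. norm (G x) \<le> norm x * K"
    using bounded_linear.pos_bounded[OF G(1)] by blast
  \<comment> \<open>This is the remainder constant \<open>C\<close> times the square of the factor
    \<open>2 * K\<close> in \<open>inv\<close>.\<close>
  define M where "M = 4 * K\<^sup>2 * C"
  have M: "0 < M"
    using K C by (simp add: M_def)
  have "isCont F u0"
    using F' U(2) has_derivative_continuous by blast
  then obtain s where s: "s > 0" "\<And>u. dist u u0 < s \<Longrightarrow> dist (F u) (F u0) < 1 / (8 * M)"
    using M unfolding continuous_at_eps_delta by (metis zero_less_divide_1_iff zero_less_mult_iff zero_less_numeral)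
  \<comment> \<open>The bound \<open>s\<close> keeps the image within 1 / (8 M) of
    \<open>F u0\<close>, as the smallness condition on the piece demands. The last bound limits the
    error 3 C \<rho> |v - u|, of which 2 C \<rho> comes from the remainder and C \<rho> from
    replacing \<open>F' u\<close> by \<open>F' u0\<close>; multiplied by \<open>K\<close> it is
    absorbed as half of |v - u|.\<close>
  define \<rho> where "\<rho> = min (min r s) (1 / (6 * K * C))"
  have \<rho>: "0 < \<rho>" "\<rho> \<le> r" "\<rho> \<le> s"
    using r s K C by (auto simp: \<rho>_def)
  have "\<rho> \<le> 1 / (6 * K * C)"
    by (simp add: \<rho>_def)
  then have \<rho>_small: "K * (3 * C * \<rho>) \<le> 1/2"
    using K C by (simp add: field_simps)
  let ?V = "ball u0 \<rho>"
  have VU: "?V \<subseteq> ball u0 r" "?V \<subseteq> U"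
    using \<rho>(2) r(2) by auto
  have inv: "norm (v - u) \<le> 2 * K * norm (F v - F u)" if uv: "u \<in> ?V" "v \<in> ?V" for u v
  proof -
    have uv': "u \<in> ball u0 r" "v \<in> ball u0 r" "u0 \<in> ball u0 r"
      using uv VU(1) r(1) by auto
    have "norm (v - u) \<le> 2 * \<rho>"
      using uv norm_triangle_ineq4[of "v - u0" "u - u0"] by (simp add: dist_norm norm_minus_commute)
    then have "C * norm (v - u) * norm (v - u) \<le> C * (2 * \<rho>) * norm (v - u)"
      using C by (intro mult_right_mono mult_left_mono) auto
    then have 1: "norm (F v - F u - F' u (v - u)) \<le> 2 * C * \<rho> * norm (v - u)"
      using rem[OF uv'(1,2)] by (simp add: power2_eq_square mult_ac)
    have "norm (F' u - F' u0) \<le> C * \<rho>"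
      using lip[OF uv'(3,1)] uv(1) C
      by (smt (verit, best) dist_norm dist_commute mem_ball mult_left_mono)
    then have 2: "norm ((F' u - F' u0) (v - u)) \<le> C * \<rho> * norm (v - u)"
      by (meson mult_right_mono norm_blinfun norm_ge_zero order_trans)
    have "F' u0 (v - u) = (F v - F u) - (F v - F u - F' u (v - u)) - (F' u - F' u0) (v - u)"
      by (simp add: blinfun.diff_left)
    then have "norm (F' u0 (v - u)) \<le> norm (F v - F u) + 3 * C * \<rho> * norm (v - u)"
      using 1 2 norm_triangle_ineq4[of "F v - F u" "F v - F u - F' u (v - u)"]
        norm_triangle_ineq4[of "(F v - F u) - (F v - F u - F' u (v - u))" "(F' u - F' u0) (v - u)"]
      by simp
    then have "K * norm (F' u0 (v - u)) \<le> K * (norm (F v - F u) + 3 * C * \<rho> * norm (v - u))"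
      using K(1) by (intro mult_left_mono) auto
    moreover have "norm (v - u) \<le> K * norm (F' u0 (v - u))"
      using K(2)[of "F' u0 (v - u)"] G(2)[of "v - u"] fre[OF U(2)] by (simp add: mult.commute)
    moreover have "K * (3 * C * \<rho>) * norm (v - u) \<le> 1/2 * norm (v - u)"
      using \<rho>_small by (intro mult_right_mono) auto
    ultimately show ?thesis
      by (simp add: algebra_simps)
  qed
  have "\<exists>n. norm n = 1 \<and> (\<forall>v. n \<bullet> F' u v = 0)" if "u \<in> U" for u
    using unit_normal_exists[of "blinfun_apply (F' u)"] dim[OF that] fre[OF that] by metis
  then obtain n where n: "\<And>u. u \<in> U \<Longrightarrow> norm (n u) = 1" "\<And>u v. u \<in> U \<Longrightarrow> n u \<bullet> F' u v = 0"
    by metis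
  have "thin (F ` ?V)"
  proof (rule thin_if_quadratic_contact[where \<nu> = "n \<circ> inv_into ?V F"])
    fix p assume p: "p \<in> F ` ?V"
    let ?u = "inv_into ?V F p"
    have u: "?u \<in> ?V" "F ?u = p"
      using p by (rule inv_into_into, rule f_inv_into_f)
    show "norm ((n \<circ> inv_into ?V F) p) = 1"
      using u(1) VU(2) n(1) by auto
    show "norm (p - F u0) \<le> 1 / (8 * M)"
      using s(2)[of ?u] u \<rho>(3) by (simp add: dist_commute dist_norm[symmetric])
    fix q assume "q \<in> F ` ?V"
    then obtain v where v: "v \<in> ?V" "q = F v" by blast
    \<comment> \<open>The normal annihilates the first-order term, leaving only the
      remainder.\<close>
    have "n ?u \<bullet> (q - p) = n ?u \<bullet> (F v - F ?u - F' ?u (v - ?u))"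
      using n(2)[of ?u "v - ?u"] u VU(2) v(2) by (auto simp: inner_diff_right)
    then have "\<bar>n ?u \<bullet> (q - p)\<bar> \<le> norm (F v - F ?u - F' ?u (v - ?u))"
      using Cauchy_Schwarz_ineq2[of "n ?u" "F v - F ?u - F' ?u (v - ?u)"] n(1)[of ?u] u(1) VU(2)
      by auto
    also have "\<dots> \<le> C * (norm (v - ?u))\<^sup>2"
      using rem u(1) v(1) VU(1) by blast
    also have "\<dots> \<le> C * (2 * K * norm (q - p))\<^sup>2"
      using inv[OF u(1) v(1)] u(2) v(2) C by (intro mult_left_mono power_mono) auto
    finally show "\<bar>(n \<circ> inv_into ?V F) p \<bullet> (q - p)\<bar> \<le> M * (norm (q - p))\<^sup>2"
      by (simp add: M_def power_mult_distrib mult_ac)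
  qed (use M in auto)
  with \<rho>(1) that[of ?V] show ?thesis by simp
qed

section \<open>The rank condition and the countable cover\<close>

text \<open>The image of \<open>B\<close> spans a space of dimension \<open>card B\<close>, so it
  cannot have fewer elements than \<open>B\<close> and must be independent. Arguing with a spanning
  set also covers a domain of dimension 0.\<close>

lemma linear_full_rank_inj:
  fixes f :: "'b::real_vector \<Rightarrow> 'a::euclidean_space" and B :: "'b set"
  assumes "linear f" "finite B" "span B = UNIV" "card B = dim (range f)"
  shows "inj f"
proof -
  have range: "range f = span (f ` B)"
    using linear_span_image[OF assms(1), of B] assms(3) by simp
  have "dim (range f) \<le> card (f ` B)"
    using assms(2) by (intro dim_le_card) (auto simp: range)
  moreover have "card (f ` B) \<le> card B"
    by (rule card_image_le[OF assms(2)])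
  ultimately have card: "card (f ` B) = card B"
    using assms(4) by simp
  then have "independent (f ` B)"
    using assms(2,4) by (intro card_le_dim_spanning[of _ "range f"]) (auto simp: range[symmetric])
  moreover have "inj_on f B"
    using card assms(2) by (rule eq_card_imp_inj_on[rotated])
  ultimately have "inj_on f (span B)"
    using assms(1) by (intro linear_inj_on_span_independent_image)
  with assms(3) show ?thesis by simp
qed

theorem theorem4p7:
  fixes U :: "'b::real_inner set"
    and B :: "'b set"
    and F :: "'b \<Rightarrow> real ^ 'n"
  assumes "finite B" and "independent B" and "span B = UNIV" and "card B = CARD('n) - 1"
    and "open U"
    and "C2_on U F"
    and "\<forall>x\<in>U. dim (range (frechet_derivative F (at x))) = CARD('n) - 1"
  shows "gamma_measure (F ` U) = 0"
proof -
  have "\<exists>G :: real ^ 'n \<Rightarrow> 'b. bounded_linear G \<and> (\<forall>v. G (frechet_derivative F (at u) v) = v)"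
    if u: "u \<in> U" for u
  proof -
    have "F differentiable (at u)"
      using assms(6) u unfolding C2_on_def differentiable_def by blast
    then have lin: "linear (frechet_derivative F (at u))"
      by (rule linear_frechet_derivative)
    then have "inj (frechet_derivative F (at u))"
      using assms u by (intro linear_full_rank_inj[of _ B]) auto
    then obtain G where "linear G" "G \<circ> frechet_derivative F (at u) = id"
      using linear_injective_left_inverse[OF lin] by blast
    then show ?thesis
      by (metis linear_conv_bounded_linear comp_apply id_apply)
  qed
  then obtain G :: "'b \<Rightarrow> real ^ 'n \<Rightarrow> 'b" where G: "\<And>u. u \<in> U \<Longrightarrow> bounded_linear (G u)"
      "\<And>u v. u \<in> U \<Longrightarrow> G u (frechet_derivative F (at u) v) = v"
    by metis
  have "\<exists>V. open V \<and> u \<in> V \<and> thin (F ` V)" if u: "u \<in> U" for u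
    using C2_immersion_locally_thin[OF assms(6,5) u G(1,2)[OF u]] assms(7)
    by (metis DIM_cart DIM_real mult.right_neutral diff_less zero_less_card_finite zero_less_one)
  then obtain V where V: "\<And>u. u \<in> U \<Longrightarrow> open (V u)" "\<And>u. u \<in> U \<Longrightarrow> u \<in> V u"
      "\<And>u. u \<in> U \<Longrightarrow> thin (F ` V u)"
    by metis
  show ?thesis
  proof (cases "U = {}")
    case True
    then show ?thesis
      using gamma_measure_thin_UN[of "\<lambda>_. {} :: (real ^ 'n) set"] thin_empty by simp
  next
    case False
    then obtain u0 where u0: "u0 \<in> U" by blast
    \<comment> \<open>\<open>Lindelof\<close> concerns second countable spaces, and
      \<open>'b\<close> is only known to be an inner product space. The cover is therefore pulled
      back to the Euclidean target along the continuous surjection \<open>H\<close>, and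
      surjectivity carries the countable subcover back.\<close>
    define H where "H = G u0"
    have contH: "continuous_on UNIV H"
      unfolding H_def using G(1)[OF u0] by (rule linear_continuous_on)
    have surjH: "surj H"
      unfolding H_def using G(2)[OF u0] by (metis surjI)
    have "open (H -` V u)" if "u \<in> U" for u
      using V(1)[OF that] contH by (rule open_vimage)
    then obtain \<W> where \<W>: "\<W> \<subseteq> (\<lambda>u. H -` V u) ` U" "countable \<W>"
        "\<Union>\<W> = (\<Union>u\<in>U. H -` V u)"
      using Lindelof[of "(\<lambda>u. H -` V u) ` U"] by (metis (no_types, lifting) imageE)
    obtain U' where U': "countable U'" "U' \<subseteq> U" "\<W> = (\<lambda>u. H -` V u) ` U'"
      using \<W>(1,2) countable_subset_image by metis
    have cover: "U \<subseteq> (\<Union>u\<in>U'. V u)"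
    proof
      fix u assume "u \<in> U"
      obtain x where x: "u = H x"
        using surjH by blast
      have "x \<in> \<Union>\<W>"
        using \<open>u \<in> U\<close> V(2) x \<W>(3) by blast
      then show "u \<in> (\<Union>u\<in>U'. V u)"
        using x U'(3) by blast
    qed
    with u0 have "U' \<noteq> {}" by blast
    then obtain c :: "nat \<Rightarrow> 'b" where c: "U' = range c"
      using U'(1) by (metis uncountable_def)
    \<comment> \<open>Intersecting with \<open>U\<close> gives equality, since the choice of
      \<open>V\<close> does not record that its members lie in \<open>U\<close>.\<close>
    have "F ` U = (\<Union>i. F ` (V (c i) \<inter> U))"
      using cover c by blast
    moreover have "thin (F ` (V (c i) \<inter> U))" for i
      using U'(2) c by (intro thin_subset[OF V(3)]) auto
    ultimately show ?thesis
      by (simp add: gamma_measure_thin_UN)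
  qed
qed

end
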